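(* The average number $\mathbb{E}(C^{\mathrm{ct}}_n)$ of comparisons made by the dual-pivot quicksort algorithm ``Count'' on a uniformly random permutation of $n$ distinct elements satisfies, as $n\to\infty$, $$\mathbb{E}(C^{\mathrm{ct}}_n)=\frac95 n\log n+An+B\log n+C+\frac{D}{n}+\frac{E}{n^2}+\frac{F\,[n\text{ even}]+G}{n^3}+O\Bigl(\frac1{n^4}\Bigr)$$ with $A=\frac95\gamma+\frac15\log 2-\frac{89}{25}=-2.3823823670652\dots$, $B=\frac{67}{40}$, $C=\frac{67}{40}\gamma+\frac{3}{40}\log 2+\frac{637}{800}=1.81507227725206\dots$, $D=\frac{11}{16}$, $E=-\frac{67}{480}$, $F=-\frac18$, $G=\frac{31}{400}$.
   Context: Notation: $\log$ is the natural logarithm, $\gamma$ is the Euler--Mascheroni constant, and $[\mathit{expr}]$ is $1$ if $\mathit{expr}$ is true and $0$ otherwise. Dual-pivot quicksort: the input is a sequence $(a_1,\dots,a_n)$ of $n$ distinct numbers in uniformly random order (w.l.o.g. a uniformly random permutation of $\{1,\dots,n\}$). If $n\le 1$, nothing is done (0 comparisons). If $n\ge2$, one comparison of $a_1$ and $a_n$ determines the pivots $p=\min(a_1,a_n)$ and $q=\max(a_1,a_n)$. Then the remaining $n-2$ elements $a_2,\dots,a_{n-1}$ are classified one after another as small ($<p$), medium (between $p$ and $q$) or large ($>q$). Each element is compared first with one of the two pivots, as prescribed by the classification strategy, and is then compared with the other pivot exactly if its class is not yet determined (so a small element costs 1 comparison if compared with $p$ first and 2 if compared with $q$ first; a large element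 costs 1 if compared with $q$ first and 2 if compared with $p$ first; a medium element always costs 2). Finally the algorithm is applied recursively, with the same strategy, to the group of small, the group of medium and the group of large elements (the inputs of the recursive calls are again in uniformly random order, e.g. if the original relative order is kept). Only comparisons between elements are counted. Strategy ``Count'': let $s_i$, $\ell_i$ be the numbers of elements classified as small, respectively large, among the first $i$ classified elements of the current partitioning step ($s_0=\ell_0=0$). When classifying the $i$th element, $1\le i\le n-2$: if $s_{i-1}\ge \ell_{i-1}$, compare with $p$ first, otherwise compare with $q$ first. $C^{\mathrm{ct}}_n$ is the random variable giving the total number of comparisons (including all recursive calls) when sorting $n$ elements with strategy ``Count''. *)

theory Defs
  imports "HOL-Probability.Probability" "HOL-Combinatorics.Multiset_Permutations"
begin

text \<open>
  Comparisons made by strategy ``Count'' while classifying the given elements from left to right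
  with respect to the pivots \<open>p < q\<close>; the arguments \<open>s\<close> and \<open>l\<close> are the numbers of elements
  already classified as small and as large in this partitioning step. The outer case
  distinction selects the pivot used first; the second comparison takes place exactly if the
  first one leaves the class open.
\<close>

fun classification_cost :: "'a::linorder \<Rightarrow> 'a \<Rightarrow> nat \<Rightarrow> nat \<Rightarrow> 'a list \<Rightarrow> nat" where
  "classification_cost p q s l [] = 0"
| "classification_cost p q s l (x # xs) =
     (if s \<ge> l then (if x < p then 1 else 2) else (if x > q then 1 else 2)) +
     classification_cost p q (if x < p then s + 1 else s) (if x > q then l + 1 else l) xs"

text \<open>
  Total number of comparisons of dual-pivot quicksort with strategy ``Count''. The groups of
  small, medium and large elements keep their original relative order. The definition is meant
  for lists of distinct elements.
\<close>

function count_comparisons :: "'a::linorder list \<Rightarrow> nat" where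
  "count_comparisons xs =
     (if length xs \<le> 1 then 0
      else
        (let p = min (hd xs) (last xs);
             q = max (hd xs) (last xs);
             ys = butlast (tl xs)
         in 1 + classification_cost p q 0 0 ys
              + count_comparisons (filter (\<lambda>y. y < p) ys)
              + count_comparisons (filter (\<lambda>y. p < y \<and> y < q) ys)
              + count_comparisons (filter (\<lambda>y. y > q) ys)))"
  by pat_completeness auto

termination
proof -
  have less: "length (filter P (butlast (tl xs))) < length xs"
    if "\<not> length xs \<le> 1" for P and xs :: "'a list"
    using that length_filter_le[of P "butlast (tl xs)"] by simp
  show ?thesis
    by (relation "Wellfounded.measure length") (simp_all only: wf_measure in_measure less not_False_eq_True)
qed

declare count_comparisons.simps [simp del]

definition random_input :: "nat \<Rightarrow> nat list pmf" where
  "random_input n = pmf_of_set (permutations_of_set {1..n})"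

definition expected_comparisons :: "nat \<Rightarrow> real" where
  "expected_comparisons n =
     measure_pmf.expectation (random_input n) (\<lambda>xs. real (count_comparisons xs))"

end

theory Submission
  imports Defs "HOL-Real_Asymp.Real_Asymp"
begin

text \<open>
  The numbers \<open>(s, m, l)\<close> of small, medium and large elements are uniformly distributed over the
  triples with sum \<open>n - 2\<close>. Conditioning on the last classified element turns the sum over all
  triples of the mean classification cost into a one-term recurrence whose inhomogeneous part is
  the sum of \<open>max s l\<close>, so the partitioning cost is elementary in harmonic and
  alternating harmonic numbers. The second difference of the divide-and-conquer recurrence is a
  three-term recurrence, and the exact solution for \<open>n \<ge> 4\<close> is verified by induction. Finally, the
  alternating harmonic numbers reduce to \<open>harm k - harm (2 * k)\<close>, and the harmonic numbers are
  enclosed between consecutive partial sums of their asymptotic series; the enclosure at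
  \<open>n = 64\<close> also gives the decimals of \<open>A\<close> and \<open>C\<close>.
\<close>

subsection \<open>Sums over permutations\<close>

lemma sum_permutations_of_set_Cons:
  fixes f :: "'a list \<Rightarrow> 'b :: comm_monoid_add"
  assumes "finite A" "A \<noteq> {}"
  shows "(\<Sum>xs\<in>permutations_of_set A. f xs) =
    (\<Sum>x\<in>A. \<Sum>xs\<in>permutations_of_set (A - {x}). f (x # xs))"
proof -
  have "(\<Sum>xs\<in>permutations_of_set A. f xs) =
    (\<Sum>x\<in>A. \<Sum>xs\<in>(#) x ` permutations_of_set (A - {x}). f xs)"
    unfolding permutations_of_set_nonempty[OF assms(2)]
    by (rule sum.UNION_disjoint) (use assms in auto)
  also have "\<dots> = (\<Sum>x\<in>A. \<Sum>xs\<in>permutations_of_set (A - {x}). f (x # xs))"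
    by (rule sum.cong[OF refl], subst sum.reindex) (auto simp: inj_on_def)
  finally show ?thesis .
qed

lemma sum_permutations_of_set_rev:
  "(\<Sum>xs\<in>permutations_of_set A. f (rev xs)) = (\<Sum>xs\<in>permutations_of_set A. f xs)"
proof -
  have "(\<Sum>xs\<in>permutations_of_set A. f xs) = (\<Sum>xs\<in>rev ` permutations_of_set A. f xs)"
    by simp
  also have "\<dots> = (\<Sum>xs\<in>permutations_of_set A. f (rev xs))"
    by (subst sum.reindex) (auto simp: inj_on_def)
  finally show ?thesis by simp
qed

lemma sum_permutations_of_set_snoc:
  fixes f :: "'a list \<Rightarrow> 'b :: comm_monoid_add"
  assumes "finite A" "A \<noteq> {}"
  shows "(\<Sum>xs\<in>permutations_of_set A. f xs) =
    (\<Sum>x\<in>A. \<Sum>xs\<in>permutations_of_set (A - {x}). f (xs @ [x]))"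
proof -
  have "(\<Sum>xs\<in>permutations_of_set A. f xs) = (\<Sum>xs\<in>permutations_of_set A. f (rev xs))"
    by (rule sum_permutations_of_set_rev [symmetric])
  also have "\<dots> = (\<Sum>x\<in>A. \<Sum>xs\<in>permutations_of_set (A - {x}). f (rev xs @ [x]))"
    by (subst sum_permutations_of_set_Cons) (use assms in auto)
  also have "\<dots> = (\<Sum>x\<in>A. \<Sum>xs\<in>permutations_of_set (A - {x}). f (xs @ [x]))"
    by (intro sum.cong refl sum_permutations_of_set_rev [where f = "\<lambda>xs. f (xs @ [_])"])
  finally show ?thesis .
qed

text \<open>The first and the last element are the pivots; splitting off both leaves the sum over
  all orders of the elements that are to be classified.\<close>

lemma sum_permutations_of_set_Cons_snoc:
  fixes f :: "'a list \<Rightarrow> 'b :: comm_monoid_add"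
  assumes "finite A" "card A \<ge> 2"
  shows "(\<Sum>xs\<in>permutations_of_set A. f xs) =
    (\<Sum>x\<in>A. \<Sum>y\<in>A - {x}. \<Sum>xs\<in>permutations_of_set (A - {x, y}). f (x # xs @ [y]))"
proof -
  have ne: "A - {x} \<noteq> {}" for x
  proof
    assume "A - {x} = {}"
    hence "A \<subseteq> {x}" by blast
    hence "card A \<le> card {x}" by (intro card_mono) auto
    with assms show False by simp
  qed
  have eq: "A - {x} - {y} = A - {x, y}" for x y by blast
  show ?thesis
    by (subst sum_permutations_of_set_Cons)
       (use assms ne in \<open>auto intro!: sum.cong simp: sum_permutations_of_set_snoc eq\<close>)
qed

text \<open>Filtering a uniformly random permutation yields a uniformly random permutation of the
  selected elements. This keeps the inputs of the recursive calls uniform; dividing by factorials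
  turns both sums into expectations.\<close>

lemma sum_permutations_of_set_filter:
  fixes f :: "'a list \<Rightarrow> real"
  assumes "finite A"
  shows "(\<Sum>xs\<in>permutations_of_set A. f (filter P xs)) / fact (card A) =
    (\<Sum>xs\<in>permutations_of_set {x\<in>A. P x}. f xs) / fact (card {x\<in>A. P x})"
proof -
  have "map_pmf (filter P) (pmf_of_set (permutations_of_set A)) =
    map_pmf fst (map_pmf (partition P) (pmf_of_set (permutations_of_set A)))"
    by (simp add: pmf.map_comp o_def)
  also have "\<dots> = pmf_of_set (permutations_of_set {x\<in>A. P x})"
    using assms by (simp add: partition_random_permutations map_fst_pair_pmf)
  finally have "measure_pmf.expectation (map_pmf (filter P) (pmf_of_set (permutations_of_set A))) f =
    measure_pmf.expectation (pmf_of_set (permutations_of_set {x\<in>A. P x})) f" by simp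
  thus ?thesis using assms by (simp add: integral_pmf_of_set)
qed

subsection \<open>The cost of one partitioning step\<close>

text \<open>The cost of what follows depends on a prefix only through its numbers of small and large
  elements, so the last element can be split off.\<close>

lemma classification_cost_append:
  "classification_cost p q s l (xs @ ys) = classification_cost p q s l xs +
     classification_cost p q (s + length (filter (\<lambda>x. x < p) xs))
       (l + length (filter (\<lambda>x. x > q) xs)) ys"
  by (induction xs arbitrary: s l) auto

text \<open>
  Conditioning on the last element instead of the first one keeps the initial counts at \<open>0\<close>: the
  counts that decide its cost are those of the other elements.
\<close>

function mean_classification_cost :: "nat \<Rightarrow> nat \<Rightarrow> nat \<Rightarrow> real" where
  "mean_classification_cost s m l =
     (if s + m + l = 0 then 0 else
       ((if s = 0 then 0
         else real s * (mean_classification_cost (s - 1) m l + (if s - 1 \<ge> l then 1 else 2))) +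
        (if m = 0 then 0 else real m * (mean_classification_cost s (m - 1) l + 2)) +
        (if l = 0 then 0
         else real l * (mean_classification_cost s m (l - 1) + (if s \<ge> l - 1 then 2 else 1))))
       / real (s + m + l))"
  by pat_completeness auto
termination by (relation "Wellfounded.measure (\<lambda>(s, m, l). s + m + l)") auto

declare mean_classification_cost.simps [simp del]

lemma mean_classification_cost_0: "mean_classification_cost 0 0 0 = 0"
  by (simp add: mean_classification_cost.simps)

text \<open>A term with a truncated predecessor such as \<open>0 - 1\<close> carries the factor 0,
  so no case distinction on empty groups is left. Multiplying by the total size also covers the
  empty triple.\<close>

lemma mean_classification_cost_rec:
  "real (s + m + l) * mean_classification_cost s m l =
     real s * (mean_classification_cost (s - 1) m l + (if s - 1 \<ge> l then 1 else 2)) +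
     real m * (mean_classification_cost s (m - 1) l + 2) +
     real l * (mean_classification_cost s m (l - 1) + (if s \<ge> l - 1 then 2 else 1))"
proof (cases "s + m + l = 0")
  case False
  thus ?thesis
    by (subst mean_classification_cost.simps)
       (simp only: if_False if_distrib[where f = "\<lambda>x. x / _"], auto)
qed auto

lemma length_filter_permutations_of_set:
  assumes "xs \<in> permutations_of_set A"
  shows "length (filter P xs) = card {x\<in>A. P x}"
proof -
  have "set (filter P xs) = {x\<in>A. P x}" "distinct (filter P xs)"
    using assms by (auto simp: permutations_of_set_def)
  thus ?thesis by (metis distinct_card)
qed

text \<open>Induction on the number of elements, splitting off the last one, \<open>y\<close>. Its
  cost is determined by its class and the sizes of the other groups, and the elements before it run
  through all permutations of \<open>Y - {y}\<close>. Hence only the three group sizes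
  matter.\<close>

lemma sum_classification_cost:
  fixes Y :: "'a :: linorder set"
  assumes "finite Y" "p < q" "p \<notin> Y" "q \<notin> Y"
  shows "(\<Sum>ys\<in>permutations_of_set Y. real (classification_cost p q 0 0 ys)) =
    fact (card Y) * mean_classification_cost (card {y\<in>Y. y < p})
      (card {y\<in>Y. p < y \<and> y < q}) (card {y\<in>Y. q < y})"
  using assms
proof (induction "card Y" arbitrary: Y)
  case 0
  thus ?case by (simp add: mean_classification_cost_0)
next
  case (Suc n Y)
  define S where "S = {y\<in>Y. y < p}"
  define M where "M = {y\<in>Y. p < y \<and> y < q}"
  define L where "L = {y\<in>Y. q < y}"
  let ?h = mean_classification_cost
  note fin = Suc.prems(1)
  have fins: "finite S" "finite M" "finite L" using fin by (auto simp: S_def M_def L_def)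
  have Y: "Y = S \<union> M \<union> L"
  proof -
    have "y < p \<or> (p < y \<and> y < q) \<or> q < y" if "y \<in> Y" for y
      using that Suc.prems by (metis linorder_neqE)
    thus ?thesis by (auto simp: S_def M_def L_def)
  qed
  have disj: "S \<inter> M = {}" "(S \<union> M) \<inter> L = {}"
    using Suc.prems by (auto simp: S_def M_def L_def)
  have cardY: "card Y = card S + card M + card L"
    unfolding Y using fins disj by (simp add: card_Un_disjoint)
  have ne: "Y \<noteq> {}" using Suc.hyps(2) by auto
  \<comment> \<open>\<open>\<kappa> y s l\<close> is the cost of classifying \<open>y\<close> after
    \<open>s\<close> small and \<open>l\<close> large elements.\<close>
  define \<kappa> where "\<kappa> y s l = (if s \<ge> l then (if y < p then 1 else 2) else (if y > q then 1 else 2) :: real)"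
    for y and s l :: nat
  have step: "(\<Sum>ys\<in>permutations_of_set (Y - {y}). real (classification_cost p q 0 0 (ys @ [y]))) =
      fact n * (?h (card (S - {y})) (card (M - {y})) (card (L - {y})) +
        \<kappa> y (card (S - {y})) (card (L - {y})))"
    if y: "y \<in> Y" for y
  proof -
    have eqs: "{x\<in>Y - {y}. x < p} = S - {y}" "{x\<in>Y - {y}. p < x \<and> x < q} = M - {y}"
      "{x\<in>Y - {y}. q < x} = L - {y}"
      by (auto simp: S_def M_def L_def)
    have card: "card (Y - {y}) = n" using y fin Suc.hyps(2) by simp
    have "real (classification_cost p q 0 0 (ys @ [y])) =
        real (classification_cost p q 0 0 ys) + \<kappa> y (card (S - {y})) (card (L - {y}))"
      if "ys \<in> permutations_of_set (Y - {y})" for ys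
      using length_filter_permutations_of_set[OF that, of "\<lambda>x. x < p"]
        length_filter_permutations_of_set[OF that, of "\<lambda>x. x > q"]
      unfolding eqs by (simp add: classification_cost_append \<kappa>_def)
    hence "(\<Sum>ys\<in>permutations_of_set (Y - {y}). real (classification_cost p q 0 0 (ys @ [y]))) =
      (\<Sum>ys\<in>permutations_of_set (Y - {y}). real (classification_cost p q 0 0 ys)) +
        fact n * \<kappa> y (card (S - {y})) (card (L - {y}))"
      using fin card by (simp add: sum.distrib)
    also have "(\<Sum>ys\<in>permutations_of_set (Y - {y}). real (classification_cost p q 0 0 ys)) =
      fact n * ?h (card (S - {y})) (card (M - {y})) (card (L - {y}))"
      using Suc.hyps(1)[of "Y - {y}"] Suc.prems card unfolding eqs by simp
    finally show ?thesis by (simp add: algebra_simps)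
  qed
  \<comment> \<open>The sum over the last element is split by its class; within one class all
    summands agree, which produces the factors \<open>card S\<close>, \<open>card M\<close> and
    \<open>card L\<close> of the recurrence.\<close>
  have S: "(\<Sum>y\<in>S. ?h (card (S - {y})) (card (M - {y})) (card (L - {y})) +
        \<kappa> y (card (S - {y})) (card (L - {y}))) =
      real (card S) * (?h (card S - 1) (card M) (card L) + (if card S - 1 \<ge> card L then 1 else 2))"
  proof -
    have "?h (card (S - {y})) (card (M - {y})) (card (L - {y})) +
        \<kappa> y (card (S - {y})) (card (L - {y})) =
        ?h (card S - 1) (card M) (card L) + (if card S - 1 \<ge> card L then 1 else 2)"
      if "y \<in> S" for y
    proof -
      have "M - {y} = M" "L - {y} = L" using that disj by auto
      moreover have "y < p" "\<not> q < y" using that \<open>p < q\<close> by (auto simp: S_def)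
      ultimately show ?thesis using that fins by (simp add: \<kappa>_def)
    qed
    thus ?thesis by simp
  qed
  have M: "(\<Sum>y\<in>M. ?h (card (S - {y})) (card (M - {y})) (card (L - {y})) +
        \<kappa> y (card (S - {y})) (card (L - {y}))) =
      real (card M) * (?h (card S) (card M - 1) (card L) + 2)"
  proof -
    have "?h (card (S - {y})) (card (M - {y})) (card (L - {y})) +
        \<kappa> y (card (S - {y})) (card (L - {y})) =
        ?h (card S) (card M - 1) (card L) + 2"
      if "y \<in> M" for y
    proof -
      have "S - {y} = S" "L - {y} = L" using that disj by auto
      moreover have "\<not> y < p" "\<not> q < y" using that \<open>p < q\<close> by (auto simp: M_def)
      ultimately show ?thesis using that fins by (simp add: \<kappa>_def)
    qed
    thus ?thesis by simp
  qed
  have L: "(\<Sum>y\<in>L. ?h (card (S - {y})) (card (M - {y})) (card (L - {y})) +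
        \<kappa> y (card (S - {y})) (card (L - {y}))) =
      real (card L) * (?h (card S) (card M) (card L - 1) + (if card S \<ge> card L - 1 then 2 else 1))"
  proof -
    have "?h (card (S - {y})) (card (M - {y})) (card (L - {y})) +
        \<kappa> y (card (S - {y})) (card (L - {y})) =
        ?h (card S) (card M) (card L - 1) + (if card S \<ge> card L - 1 then 2 else 1)"
      if "y \<in> L" for y
    proof -
      have "S - {y} = S" "M - {y} = M" using that disj by auto
      moreover have "\<not> y < p" "q < y" using that \<open>p < q\<close> by (auto simp: L_def)
      ultimately show ?thesis using that fins by (simp add: \<kappa>_def)
    qed
    thus ?thesis by simp
  qed
  have "(\<Sum>ys\<in>permutations_of_set Y. real (classification_cost p q 0 0 ys)) =
     fact n * (\<Sum>y\<in>Y. ?h (card (S - {y})) (card (M - {y})) (card (L - {y})) +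
        \<kappa> y (card (S - {y})) (card (L - {y})))"
    by (subst sum_permutations_of_set_snoc[OF fin ne]) (simp add: step sum_distrib_left)
  also have "\<dots> = fact n * (real (card Y) * ?h (card S) (card M) (card L))"
    unfolding Y sum.union_disjoint[OF finite_UnI[OF fins(1,2)] fins(3) disj(2)]
      sum.union_disjoint[OF fins(1,2) disj(1)] S M L
    unfolding Y[symmetric] cardY mean_classification_cost_rec ..
  also have "\<dots> = fact (card Y) * ?h (card S) (card M) (card L)"
    unfolding Suc.hyps(2)[symmetric] by (simp add: algebra_simps)
  finally show ?case unfolding S_def M_def L_def .
qed

subsection \<open>The recurrence for the expected number of comparisons\<close>

text \<open>The algorithm sees only the relative order of its input, and a strictly monotone map
  preserves it.\<close>

lemma count_comparisons_map:
  assumes "strict_mono f"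
  shows "count_comparisons (map f xs) = count_comparisons xs"
proof (induction xs rule: count_comparisons.induct)
  case (1 xs)
  have cost: "classification_cost (f p) (f q) s l (map f ys) = classification_cost p q s l ys"
    for p q s l ys
    using assms by (induction ys arbitrary: s l) (auto simp: strict_mono_less)
  have mm: "min (f a) (f b) = f (min a b)" "max (f a) (f b) = f (max a b)" for a b
    using assms by (auto simp: min_def max_def strict_mono_less_eq)
  show ?case
  proof (cases "length xs \<le> 1")
    case True
    thus ?thesis by (simp add: count_comparisons.simps)
  next
    case False
    hence ne: "xs \<noteq> []" by auto
    define p q ys where "p = min (hd xs) (last xs)" "q = max (hd xs) (last xs)" "ys = butlast (tl xs)"
    note defs = this
    have fdefs: "min (hd (map f xs)) (last (map f xs)) = f p"
      "max (hd (map f xs)) (last (map f xs)) = f q" "butlast (tl (map f xs)) = map f ys"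
      using ne by (simp_all add: defs hd_map last_map map_tl map_butlast mm)
    \<comment> \<open>The two deleted rules would take conditions such as
      \<open>y < min (hd xs) (last xs)\<close> apart before the minimum is folded into
      \<open>p\<close>.\<close>
    show ?thesis
      using False 1[OF False defs]
      by (simp add: count_comparisons.simps[of xs] count_comparisons.simps[of "map f xs"]
            Let_def fdefs defs[symmetric] cost filter_map o_def strict_mono_less[OF assms]
            del: min_less_iff_conj max_less_iff_conj)
  qed
qed

lemma expected_comparisons_altdef:
  "expected_comparisons n =
     (\<Sum>xs\<in>permutations_of_set {1..n}. real (count_comparisons xs)) / fact n"
  by (simp add: expected_comparisons_def random_input_def integral_pmf_of_set)

text \<open>Each of the three groups is an interval of values. Shifting it down to start at 1 leaves
  the comparisons unchanged, so only its length counts.\<close>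

lemma expected_comparisons_interval:
  "(\<Sum>xs\<in>permutations_of_set {c<..c + n}. real (count_comparisons xs)) / fact n =
     expected_comparisons n"
proof -
  have mono: "strict_mono (\<lambda>x. x + c :: nat)" by (auto intro: strict_monoI)
  have "{c<..c + n} = (\<lambda>x. x + c) ` {1..n}"
    by (simp add: image_add_atLeastAtMost' atLeastSucAtMost_greaterThanAtMost[symmetric] add.commute)
  moreover have "permutations_of_set ((\<lambda>x. x + c) ` {1..n}) =
      map (\<lambda>x. x + c) ` permutations_of_set {1..n}"
    by (rule permutations_of_set_image_inj) (auto simp: inj_on_def)
  ultimately show ?thesis unfolding expected_comparisons_altdef
    by (simp only:) (subst sum.reindex, auto simp: inj_on_def count_comparisons_map[OF mono])
qed

section \<open>Sums over the triples of group sizes\<close>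

definition triples :: "nat \<Rightarrow> (nat \<times> nat \<times> nat) set" where
  "triples n = {(s, m, l). s + m + l = n}"

lemma finite_triples [simp]: "finite (triples n)"
proof (rule finite_subset)
  show "triples n \<subseteq> {..n} \<times> {..n} \<times> {..n}" by (auto simp: triples_def)
qed auto

lemma sum_triples_swap12:
  "(\<Sum>(s, m, l)\<in>triples n. f m s l) = (\<Sum>(s, m, l)\<in>triples n. f s m l)"
  by (rule sum.reindex_bij_witness[of _ "\<lambda>(s, m, l). (m, s, l)" "\<lambda>(s, m, l). (m, s, l)"])
     (auto simp: triples_def)

lemma sum_triples_swap13:
  "(\<Sum>(s, m, l)\<in>triples n. f l m s) = (\<Sum>(s, m, l)\<in>triples n. f s m l)"
  by (rule sum.reindex_bij_witness[of _ "\<lambda>(s, m, l). (l, m, s)" "\<lambda>(s, m, l). (l, m, s)"])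
     (auto simp: triples_def)

text \<open>Replacing \<open>s\<close> by \<open>s + 1\<close> as summation index turns the weight
  \<open>s\<close> into \<open>s + 1\<close>. The swap lemmas carry this over to the other two
  components.\<close>

lemma sum_triples_Suc_weighted:
  fixes f :: "nat \<Rightarrow> nat \<Rightarrow> nat \<Rightarrow> real"
  shows "(\<Sum>(s, m, l)\<in>triples (Suc n). if s = 0 then 0 else real s * f (s - 1) m l) =
    (\<Sum>(s, m, l)\<in>triples n. real (s + 1) * f s m l)"
proof -
  have "(\<Sum>(s, m, l)\<in>triples (Suc n). if s = 0 then 0 else real s * f (s - 1) m l) =
    (\<Sum>(s, m, l)\<in>{t\<in>triples (Suc n). fst t \<noteq> 0}. real s * f (s - 1) m l)"
    by (rule sum.mono_neutral_cong_right) (auto split: if_splits)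
  also have "\<dots> = (\<Sum>(s, m, l)\<in>triples n. real (s + 1) * f s m l)"
    by (rule sum.reindex_bij_witness[of _ "\<lambda>(s, m, l). (Suc s, m, l)" "\<lambda>(s, m, l). (s - 1, m, l)"])
       (auto simp: triples_def)
  finally show ?thesis .
qed

lemma sum_triples_fst:
  fixes f :: "nat \<Rightarrow> real"
  shows "(\<Sum>(s, m, l)\<in>triples n. f s) = (\<Sum>k\<le>n. real (n + 1 - k) * f k)"
proof -
  have "(\<Sum>(s, m, l)\<in>triples n. f s) = (\<Sum>(s, m)\<in>Sigma {..n} (\<lambda>s. {..n - s}). f s)"
    by (rule sum.reindex_bij_witness[of _ "\<lambda>(s, m). (s, m, n - s - m)" "\<lambda>(s, m, l). (s, m)"])
       (auto simp: triples_def)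
  also have "\<dots> = (\<Sum>k\<le>n. real (n + 1 - k) * f k)"
    by (subst sum.Sigma[symmetric]) (auto intro!: sum.cong simp: Suc_diff_le)
  finally show ?thesis .
qed

text \<open>As \<open>f\<close> ignores the middle component, lowering a positive \<open>m\<close>
  by one maps to the triples with sum \<open>n\<close>; the triples with \<open>m = 0\<close> form
  the antidiagonal.\<close>

lemma sum_triples_Suc:
  fixes f :: "nat \<Rightarrow> nat \<Rightarrow> real"
  shows "(\<Sum>(s, m, l)\<in>triples (Suc n). f s l) =
    (\<Sum>a\<le>Suc n. f a (Suc n - a)) + (\<Sum>(s, m, l)\<in>triples n. f s l)"
proof -
  let ?A = "{t\<in>triples (Suc n). fst (snd t) = 0}" and ?B = "{t\<in>triples (Suc n). fst (snd t) \<noteq> 0}"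
  have "(\<Sum>(s, m, l)\<in>triples (Suc n). f s l) =
      (\<Sum>(s, m, l)\<in>?A. f s l) + (\<Sum>(s, m, l)\<in>?B. f s l)"
    by (subst sum.union_disjoint[symmetric]) (auto intro!: sum.cong)
  also have "(\<Sum>(s, m, l)\<in>?A. f s l) = (\<Sum>a\<le>Suc n. f a (Suc n - a))"
    by (rule sum.reindex_bij_witness[of _ "\<lambda>s. (s, 0, Suc n - s)" fst])
       (auto simp: triples_def, metis diff_add_inverse)
  also have "(\<Sum>(s, m, l)\<in>?B. f s l) = (\<Sum>(s, m, l)\<in>triples n. f s l)"
    by (rule sum.reindex_bij_witness[of _ "\<lambda>(s, m, l). (s, Suc m, l)" "\<lambda>(s, m, l). (s, m - 1, l)"])
       (auto simp: triples_def)
  finally show ?thesis .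
qed

text \<open>Induction in steps of two: from \<open>k\<close> to \<open>k + 2\<close> the two end
  points contribute \<open>k + 2\<close> each, and each of the \<open>k + 1\<close> inner terms
  grows by 1.\<close>

lemma sum_max_antidiagonal:
  "(\<Sum>a\<le>k. real (max a (k - a))) = (3 * real k ^ 2 + 4 * real k + of_bool (odd k)) / 4"
proof (induction k rule: induct_nat_012)
  case 0
  thus ?case by simp
next
  case 1
  thus ?case by simp
next
  case (ge2 k)
  have "(\<Sum>a\<le>Suc (Suc k). real (max a (Suc (Suc k) - a))) =
      2 * real (k + 2) + (\<Sum>a\<le>k. real (max (Suc a) (Suc (Suc k) - Suc a)))"
    by (subst sum.atMost_Suc_shift) (simp add: algebra_simps)
  also have "(\<Sum>a\<le>k. real (max (Suc a) (Suc (Suc k) - Suc a))) =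
      (\<Sum>a\<le>k. real (max a (k - a)) + 1)"
    by (intro sum.cong) (auto simp: max_def)
  also have "\<dots> = (\<Sum>a\<le>k. real (max a (k - a))) + (real k + 1)"
    by (simp add: sum.distrib)
  finally show ?case unfolding ge2 by (simp add: field_simps power2_eq_square)
qed

text \<open>The antidiagonal sums are added up over \<open>k \<le> n\<close>;
  \<open>(n + 1) div 2\<close> is the number of odd \<open>k\<close> among them.\<close>

lemma sum_triples_max:
  "(\<Sum>(s, m, l)\<in>triples n. real (max s l)) =
     real n * (real n + 1) * (2 * real n + 5) / 8 + real ((n + 1) div 2) / 4"
proof (induction n)
  case 0
  thus ?case by (simp add: triples_def)
next
  case (Suc n)
  show ?case unfolding sum_triples_Suc[where f = "\<lambda>s l. real (max s l)"] sum_max_antidiagonal Suc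
    by (cases "even n") (auto elim!: evenE oddE simp: field_simps power2_eq_square)
qed

lemma card_triples: "real (card (triples n)) = (real n + 1) * (real n + 2) / 2"
proof (induction n)
  case 0
  have "triples 0 = {(0, 0, 0)}" by (auto simp: triples_def)
  thus ?case by simp
next
  case (Suc n)
  have eq: "real (card (triples k)) = (\<Sum>(s, m, l)\<in>triples k. 1)" for k by simp
  show ?case unfolding eq sum_triples_Suc[where f = "\<lambda>s l. 1"] unfolding eq[symmetric] Suc
    by (simp add: field_simps)
qed

section \<open>The total cost of classification\<close>

definition total_classification_cost :: "nat \<Rightarrow> real" where
  "total_classification_cost n = (\<Sum>(s, m, l)\<in>triples n. mean_classification_cost s m l)"

lemma total_classification_cost_0: "total_classification_cost 0 = 0"
proof -
  have "triples 0 = {(0, 0, 0)}" by (auto simp: triples_def)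
  thus ?thesis by (simp add: total_classification_cost_def mean_classification_cost_0)
qed

text \<open>In urn terms, an element added to \<open>(s, m, l)\<close> is small, medium or large
  with weights \<open>s + 1\<close>, \<open>m + 1\<close>, \<open>l + 1\<close>, which sum to
  \<open>n + 3\<close>. It costs 2 comparisons, except 1 if it belongs to the class of the pivot
  used first, and the weight of that class is \<open>max s l + 1\<close>.\<close>

lemma total_classification_cost_Suc:
  "(real n + 1) * total_classification_cost (Suc n) =
     (real n + 3) * total_classification_cost n +
     (2 * (real n + 3) - 1) * ((real n + 1) * (real n + 2) / 2)
     - (\<Sum>(s, m, l)\<in>triples n. real (max s l))"
proof -
  let ?h = mean_classification_cost
  let ?a = "\<lambda>s m l. ?h s m l + (if s \<ge> l then 1 else 2)"
  let ?b = "\<lambda>s m l. ?h s m l + 2"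
  let ?c = "\<lambda>s m l. ?h s m l + (if s \<ge> l then 2 else 1)"
  have "(real n + 1) * total_classification_cost (Suc n) =
    (\<Sum>(s, m, l)\<in>triples (Suc n).
       (if s = 0 then 0 else real s * ?a (s - 1) m l) +
       (if m = 0 then 0 else real m * ?b s (m - 1) l) +
       (if l = 0 then 0 else real l * ?c s m (l - 1)))"
    unfolding total_classification_cost_def sum_distrib_left
  proof (intro sum.cong refl, goal_cases)
    case (1 t)
    obtain s m l where t: "t = (s, m, l)" by (cases t)
    with 1 have n: "real n + 1 = real (s + m + l)" by (auto simp: triples_def)
    show ?case unfolding t prod.case n mean_classification_cost_rec by auto
  qed
  also have "\<dots> =
      (\<Sum>(s, m, l)\<in>triples (Suc n). if s = 0 then 0 else real s * ?a (s - 1) m l) +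
      (\<Sum>(s, m, l)\<in>triples (Suc n). if m = 0 then 0 else real m * ?b s (m - 1) l) +
      (\<Sum>(s, m, l)\<in>triples (Suc n). if l = 0 then 0 else real l * ?c s m (l - 1))"
    by (simp add: sum.distrib[symmetric] case_prod_unfold)
  also have "(\<Sum>(s, m, l)\<in>triples (Suc n). if s = 0 then 0 else real s * ?a (s - 1) m l) =
      (\<Sum>(s, m, l)\<in>triples n. real (s + 1) * ?a s m l)"
    by (rule sum_triples_Suc_weighted)
  also have "(\<Sum>(s, m, l)\<in>triples (Suc n). if m = 0 then 0 else real m * ?b s (m - 1) l) =
      (\<Sum>(s, m, l)\<in>triples n. real (m + 1) * ?b s m l)"
    using sum_triples_Suc_weighted[of "\<lambda>m s l. ?b s m l" n]
      sum_triples_swap12[of "\<lambda>s m l. if m = 0 then 0 else real m * ?b s (m - 1) l" "Suc n"]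
      sum_triples_swap12[of "\<lambda>s m l. real (m + 1) * ?b s m l" n] by simp
  also have "(\<Sum>(s, m, l)\<in>triples (Suc n). if l = 0 then 0 else real l * ?c s m (l - 1)) =
      (\<Sum>(s, m, l)\<in>triples n. real (l + 1) * ?c s m l)"
    using sum_triples_Suc_weighted[of "\<lambda>l m s. ?c s m l" n]
      sum_triples_swap13[of "\<lambda>s m l. if l = 0 then 0 else real l * ?c s m (l - 1)" "Suc n"]
      sum_triples_swap13[of "\<lambda>s m l. real (l + 1) * ?c s m l" n] by simp
  also have "(\<Sum>(s, m, l)\<in>triples n. real (s + 1) * ?a s m l) +
      (\<Sum>(s, m, l)\<in>triples n. real (m + 1) * ?b s m l) +
      (\<Sum>(s, m, l)\<in>triples n. real (l + 1) * ?c s m l) =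
      (\<Sum>(s, m, l)\<in>triples n. (real n + 3) * ?h s m l + (2 * (real n + 3) - 1) - real (max s l))"
    unfolding sum.distrib[symmetric]
  proof (intro sum.cong refl, goal_cases)
    case (1 t)
    obtain s m l where t: "t = (s, m, l)" by (cases t)
    with 1 have n: "real n = real s + real m + real l" by (auto simp: triples_def)
    show ?case unfolding t prod.case n by (cases "s \<ge> l") (auto simp: algebra_simps max_def)
  qed
  also have "\<dots> = (real n + 3) * total_classification_cost n +
     (2 * (real n + 3) - 1) * real (card (triples n))
     - (\<Sum>(s, m, l)\<in>triples n. real (max s l))"
    by (simp add: total_classification_cost_def sum_distrib_left sum.distrib sum_subtractf
        case_prod_unfold)
  finally show ?thesis unfolding card_triples .
qed

text \<open>Pivots \<open>p < q\<close> correspond to group sizes by \<open>p = s + 1\<close> and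
  \<open>q = s + m + 2\<close>. The factor 2 stands for the two orders in which they can occupy the
  ends of the list.\<close>

lemma sum_distinct_pairs:
  fixes f :: "nat \<Rightarrow> nat \<Rightarrow> real"
  shows "(\<Sum>a\<in>{1..n+2}. \<Sum>b\<in>{1..n+2} - {a}. f (min a b) (max a b)) =
    2 * (\<Sum>(s, m, l)\<in>triples n. f (s + 1) (s + m + 2))"
proof -
  let ?L = "{(a, b). a \<in> {1..n+2} \<and> b \<in> {1..n+2} \<and> a < b}"
  let ?G = "{(a, b). a \<in> {1..n+2} \<and> b \<in> {1..n+2} \<and> b < a}"
  have fin: "finite ?L" "finite ?G"
    by (rule finite_subset[of _ "{1..n+2} \<times> {1..n+2}"]; force)+
  have "(\<Sum>a\<in>{1..n+2}. \<Sum>b\<in>{1..n+2} - {a}. f (min a b) (max a b)) =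
    (\<Sum>(a, b)\<in>Sigma {1..n+2} (\<lambda>a. {1..n+2} - {a}). f (min a b) (max a b))"
    by (subst sum.Sigma) auto
  also have "Sigma {1..n+2} (\<lambda>a. {1..n+2} - {a}) = ?L \<union> ?G" by auto
  also have "(\<Sum>(a, b)\<in>?L \<union> ?G. f (min a b) (max a b)) =
      (\<Sum>(a, b)\<in>?L. f (min a b) (max a b)) + (\<Sum>(a, b)\<in>?G. f (min a b) (max a b))"
    using fin by (intro sum.union_disjoint) auto
  also have "(\<Sum>(a, b)\<in>?G. f (min a b) (max a b)) = (\<Sum>(a, b)\<in>?L. f (min a b) (max a b))"
    by (rule sum.reindex_bij_witness[of _ "\<lambda>(a, b). (b, a)" "\<lambda>(a, b). (b, a)"])
       (auto simp: min.commute max.commute)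
  also have "(\<Sum>(a, b)\<in>?L. f (min a b) (max a b)) =
      (\<Sum>(s, m, l)\<in>triples n. f (s + 1) (s + m + 2))"
    by (rule sum.reindex_bij_witness[of _ "\<lambda>(s, m, l). (s + 1, s + m + 2)"
          "\<lambda>(a, b). (a - 1, b - a - 1, n + 2 - b)"])
       (auto simp: triples_def intro!: arg_cong2[where f = f])
  finally show ?thesis by simp
qed

lemma sum_count_comparisons_pivots:
  assumes "a \<in> {1..n+2}" "b \<in> {1..n+2}" "a \<noteq> b"
  defines "p \<equiv> min a b" and "q \<equiv> max a b"
  shows "(\<Sum>ys\<in>permutations_of_set ({1..n+2} - {a, b}). real (count_comparisons (a # ys @ [b])))
     / fact n = 1 + mean_classification_cost (p - 1) (q - p - 1) (n + 2 - q) +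
      expected_comparisons (p - 1) + expected_comparisons (q - p - 1) +
      expected_comparisons (n + 2 - q)"
proof -
  let ?Y = "{1..n+2} - {a, b}"
  let ?P = "permutations_of_set ?Y"
  have pq: "p < q" "p \<ge> 1" "q \<le> n + 2" using assms by (auto simp: p_def q_def)
  have Y: "?Y = {1..n+2} - {p, q}" by (auto simp: p_def q_def min_def max_def)
  \<comment> \<open>The groups are written as intervals \<open>{c<..c + k}\<close> with
    \<open>c\<close> equal to 0, \<open>p\<close> and \<open>q\<close>, the shape used by
    \<open>expected_comparisons_interval\<close>.\<close>
  have sets: "{y\<in>?Y. y < p} = {0<..0 + (p - 1)}" "{y\<in>?Y. p < y \<and> y < q} = {p<..p + (q - p - 1)}"
      "{y\<in>?Y. q < y} = {q<..q + (n + 2 - q)}"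
    using pq unfolding Y by auto
  have card: "card ?Y = n" using assms(1-3) by (simp add: card_Diff_subset)
  have cost: "(\<Sum>ys\<in>?P. real (classification_cost p q 0 0 ys)) / fact n =
      mean_classification_cost (p - 1) (q - p - 1) (n + 2 - q)"
  proof -
    have "p \<notin> ?Y" "q \<notin> ?Y" by (simp_all only: Y, simp_all)
    from sum_classification_cost[OF _ pq(1) this] show ?thesis unfolding sets card by simp
  qed
  have rec: "(\<Sum>ys\<in>?P. real (count_comparisons (filter R ys))) / fact n = expected_comparisons k"
    if "{y\<in>?Y. R y} = {c<..c + k}" for R c k
    using sum_permutations_of_set_filter[of ?Y "\<lambda>ys. real (count_comparisons ys)" R]
    unfolding that card by (simp add: expected_comparisons_interval)
  have "count_comparisons (a # ys @ [b]) = 1 + classification_cost p q 0 0 ys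
              + count_comparisons (filter (\<lambda>y. y < p) ys)
              + count_comparisons (filter (\<lambda>y. p < y \<and> y < q) ys)
              + count_comparisons (filter (\<lambda>y. y > q) ys)" for ys
    by (subst count_comparisons.simps) (simp add: p_def q_def Let_def)
  hence "(\<Sum>ys\<in>?P. real (count_comparisons (a # ys @ [b]))) / fact n =
      real (card ?P) / fact n + (\<Sum>ys\<in>?P. real (classification_cost p q 0 0 ys)) / fact n
       + (\<Sum>ys\<in>?P. real (count_comparisons (filter (\<lambda>y. y < p) ys))) / fact n
       + (\<Sum>ys\<in>?P. real (count_comparisons (filter (\<lambda>y. p < y \<and> y < q) ys))) / fact n
       + (\<Sum>ys\<in>?P. real (count_comparisons (filter (\<lambda>y. y > q) ys))) / fact n"
    by (simp add: sum.distrib add_divide_distrib)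
  also have "\<dots> = 1 + mean_classification_cost (p - 1) (q - p - 1) (n + 2 - q) +
      expected_comparisons (p - 1) + expected_comparisons (q - p - 1) +
      expected_comparisons (n + 2 - q)"
    unfolding cost rec[OF sets(1)] rec[OF sets(2)] rec[OF sets(3)]
    by (subst card_permutations_of_set) (simp_all only: card, simp_all)
  finally show ?thesis .
qed

text \<open>The mean over all inputs, grouped by their ends. The factor 6 combines the two orders of
  the pivots with the three groups, which contribute equally by symmetry.\<close>

lemma expected_comparisons_rec:
  "(real n + 1) * (real n + 2) * expected_comparisons (n + 2) =
     (real n + 1) * (real n + 2) + 2 * total_classification_cost n +
     6 * (\<Sum>k\<le>n. real (n + 1 - k) * expected_comparisons k)"
proof -
  let ?E = expected_comparisons
  let ?g = "\<lambda>p q. 1 + mean_classification_cost (p - 1) (q - p - 1) (n + 2 - q) +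
      ?E (p - 1) + ?E (q - p - 1) + ?E (n + 2 - q)"
  have fact: "fact (n + 2) = (real n + 1) * (real n + 2) * fact n" by (simp add: algebra_simps)
  have "(real n + 1) * (real n + 2) * ?E (n + 2) =
    (\<Sum>xs\<in>permutations_of_set {1..n + 2}. real (count_comparisons xs)) / fact n"
    unfolding expected_comparisons_altdef fact by simp
  also have "\<dots> = (\<Sum>a\<in>{1..n+2}. \<Sum>b\<in>{1..n+2} - {a}.
     (\<Sum>ys\<in>permutations_of_set ({1..n+2} - {a, b}). real (count_comparisons (a # ys @ [b])))
       / fact n)"
    by (subst sum_permutations_of_set_Cons_snoc) (simp_all only: sum_divide_distrib, auto)
  also have "\<dots> = (\<Sum>a\<in>{1..n+2}. \<Sum>b\<in>{1..n+2} - {a}. ?g (min a b) (max a b))"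
    by (intro sum.cong refl sum_count_comparisons_pivots) auto
  also have "\<dots> = 2 * (\<Sum>(s, m, l)\<in>triples n. ?g (s + 1) (s + m + 2))"
    by (rule sum_distinct_pairs[where f = ?g])
  also have "\<dots> = 2 * (\<Sum>(s, m, l)\<in>triples n. 1 + mean_classification_cost s m l + ?E s + ?E m + ?E l)"
    by (intro arg_cong[where f = "(*) 2"] sum.cong) (auto simp: triples_def)
  also have "\<dots> = 2 * (real (card (triples n)) + total_classification_cost n +
     (\<Sum>(s, m, l)\<in>triples n. ?E s) + (\<Sum>(s, m, l)\<in>triples n. ?E m) + (\<Sum>(s, m, l)\<in>triples n. ?E l))"
    by (simp add: total_classification_cost_def sum.distrib case_prod_unfold)
  also have "(\<Sum>(s, m, l)\<in>triples n. ?E m) = (\<Sum>(s, m, l)\<in>triples n. ?E s)"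
    by (rule sum_triples_swap12)
  also have "(\<Sum>(s, m, l)\<in>triples n. ?E l) = (\<Sum>(s, m, l)\<in>triples n. ?E s)"
    by (rule sum_triples_swap13)
  also have "(\<Sum>(s, m, l)\<in>triples n. ?E s) = (\<Sum>k\<le>n. real (n + 1 - k) * ?E k)"
    by (rule sum_triples_fst)
  finally show ?thesis unfolding card_triples by (simp add: algebra_simps)
qed

subsection \<open>The exact solution\<close>

text \<open>With this sign convention the limit is \<open>- ln 2\<close>.\<close>

definition alt_harm :: "nat \<Rightarrow> real" where
  "alt_harm n = (\<Sum>m=1..n. (- 1) ^ m / real m)"

lemma alt_harm_Suc: "alt_harm (Suc n) = alt_harm n + (- 1) ^ Suc n / (real n + 1)"
  by (simp add: alt_harm_def add.commute)

text \<open>For \<open>n \<ge> 2\<close> this is the mean number of comparisons in one partitioning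
  step on \<open>n\<close> elements, including the comparison of the pivots;
  \<open>total_classification_cost_eq\<close> proves it.\<close>

definition partition_cost :: "nat \<Rightarrow> real" where
  "partition_cost n = 3 / 2 * real n + (harm n - alt_harm n) / 4 - 19 / 8
     - (if even n then 1 / (8 * (real n - 1)) else 3 / (8 * real n))"

lemma total_classification_cost_eq:
  "(real n + 1) * (real n + 2) + 2 * total_classification_cost n =
     (real n + 1) * (real n + 2) * partition_cost (n + 2)"
proof (induction n)
  case 0
  show ?case
    by (simp add: total_classification_cost_0 partition_cost_def harm_Suc alt_harm_Suc
        numeral_2_eq_2 harm_def alt_harm_def)
next
  case (Suc n)
  have T: "total_classification_cost n =
      (real n + 1) * (real n + 2) * (partition_cost (n + 2) - 1) / 2"
    using Suc by (simp add: field_simps)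
  have "total_classification_cost (Suc n) = ((real n + 3) * total_classification_cost n +
     (2 * (real n + 3) - 1) * ((real n + 1) * (real n + 2) / 2) -
     (real n * (real n + 1) * (2 * real n + 5) / 8 + real ((n + 1) div 2) / 4)) / (real n + 1)"
    using total_classification_cost_Suc[of n] unfolding sum_triples_max
    by (simp add: field_simps)
  also have "real ((n + 1) div 2) = (real n + of_bool (odd n)) / 2"
    by (cases "even n") (auto elim!: evenE oddE)
  finally have *: "total_classification_cost (Suc n) = ((real n + 3) * total_classification_cost n +
     (2 * (real n + 3) - 1) * ((real n + 1) * (real n + 2) / 2) -
     (real n * (real n + 1) * (2 * real n + 5) / 8 + (real n + of_bool (odd n)) / 8)) / (real n + 1)"
    by simp
  show ?case unfolding * T
    by (cases "even n")
       (simp_all add: partition_cost_def harm_Suc alt_harm_Suc divide_simps, simp_all add: algebra_simps)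
qed

text \<open>From \<open>n = 4\<close> on all denominators are positive. The terms
  \<open>1 / 10\<close> and \<open>- 1 / 10\<close> compensate the leading oscillation
  \<open>(- 1) ^ n / (2 * n)\<close> of \<open>alt_harm n\<close>, which enters with the factor
  \<open>- n / 5\<close>.\<close>

definition comparisons_closed_form :: "nat \<Rightarrow> real" where
  "comparisons_closed_form n = 9 / 5 * real n * harm n - 1 / 5 * real n * alt_harm n
     - 89 / 25 * real n + 67 / 40 * harm n - 3 / 40 * alt_harm n - 83 / 800 +
     (if even n then 1 / 10 - (1 / (real n - 3) + 3 / (real n - 1)) / 320
      else - 1 / 10 + (3 / (real n - 2) + 1 / real n) / 320)"

text \<open>The sum with weights \<open>n + 1 - k\<close> is a twice iterated partial sum, so its
  second difference is a single value.\<close>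

lemma expected_comparisons_second_difference:
  "(real n + 3) * (real n + 4) * (expected_comparisons (n + 4) - partition_cost (n + 4))
    - 2 * (real n + 2) * (real n + 3) * (expected_comparisons (n + 3) - partition_cost (n + 3))
    + (real n + 1) * (real n + 2) * (expected_comparisons (n + 2) - partition_cost (n + 2)) =
    6 * expected_comparisons (n + 2)"
proof -
  let ?E = expected_comparisons
  define S where "S n = (\<Sum>k\<le>n. real (n + 1 - k) * ?E k)" for n
  have S_Suc: "S (Suc n) = S n + (\<Sum>k\<le>Suc n. ?E k)" for n
  proof -
    have "S (Suc n) = (\<Sum>k\<le>n. real (Suc n + 1 - k) * ?E k) + ?E (Suc n)"
      by (simp add: S_def)
    also have "(\<Sum>k\<le>n. real (Suc n + 1 - k) * ?E k) = (\<Sum>k\<le>n. real (n + 1 - k) * ?E k + ?E k)"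
      by (intro sum.cong) (auto simp: Suc_diff_le algebra_simps)
    finally show ?thesis by (simp add: S_def sum.distrib)
  qed
  have rec: "(real n + 1) * (real n + 2) * (?E (n + 2) - partition_cost (n + 2)) = 6 * S n" for n
    using expected_comparisons_rec[of n] total_classification_cost_eq[of n]
    by (simp add: S_def algebra_simps)
  have "S (n + 2) - 2 * S (n + 1) + S n = ?E (n + 2)"
    using S_Suc[of n] S_Suc[of "Suc n"] by simp
  thus ?thesis
    using rec[of n] rec[of "n + 1"] rec[of "n + 2"]
    by (simp add: algebra_simps numeral_eq_Suc)
qed


text \<open>The recurrence of \<open>expected_comparisons_second_difference\<close> with the index
  lowered by two. For each parity, the three values are expressed through \<open>x\<close>,
  \<open>h\<close>, \<open>a\<close> and reciprocals of linear factors, which leaves an algebraic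
  identity.\<close>

lemma closed_form_second_difference:
  assumes "n \<ge> 4"
  shows "(real n + 1) * (real n + 2) * (comparisons_closed_form (n + 2) - partition_cost (n + 2))
    - 2 * real n * (real n + 1) * (comparisons_closed_form (n + 1) - partition_cost (n + 1))
    + (real n - 1) * real n * (comparisons_closed_form n - partition_cost n) =
    6 * comparisons_closed_form n"
proof -
  define x h a :: real where "x = real n" "h = harm n" "a = alt_harm n"
  note defs = this
  define c1 c2 where "c1 = 1 / (x + 1)" "c2 = 1 / (x + 2)"
  note cdefs = this
  have c: "(x + 1) * c1 = 1" "(x + 2) * c2 = 1" by (simp_all add: defs cdefs)
  \<comment> \<open>Normalising \<open>u * x\<close> for the reciprocals \<open>u\<close> of linear factors avoids clearing denominators.\<close>
  have mult_reduce: "u * (x * z) = v * z" if "u * x = v" for u v z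
    using that by (simp add: mult.assoc[symmetric])
  have "c1 * x = 1 - c1" "c2 * x = 1 - 2 * c2" using c by (simp_all add: algebra_simps)
  note c_reduce = this this[THEN mult_reduce]
  have x: "real (n + 1) = x + 1" "real (n + 2) = x + 2" "real n = x" by (simp_all add: defs)
  have h: "harm (n + 1) = h + c1" "harm (n + 2) = h + c1 + c2"
    by (simp_all add: defs cdefs harm_Suc inverse_eq_divide add_ac)
  show ?thesis
  proof (cases "even n")
    case True
    have a: "alt_harm (n + 1) = a - c1" "alt_harm (n + 2) = a - c1 + c2"
      using True by (simp_all add: defs cdefs alt_harm_Suc add_ac)
    define d1 d3 where "d1 = 1 / (x - 1)" "d3 = 1 / (x - 3)"
    note ddefs = this
    have d: "(x - 1) * d1 = 1" "(x - 3) * d3 = 1" using assms by (simp_all add: defs ddefs)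
    have cl: "comparisons_closed_form n = 9 / 5 * x * h - 1 / 5 * x * a - 89 / 25 * x + 67 / 40 * h
        - 3 / 40 * a - 83 / 800 + 1 / 10 - (d3 + 3 * d1) / 320"
      "comparisons_closed_form (n + 1) = 9 / 5 * (x + 1) * (h + c1) - 1 / 5 * (x + 1) * (a - c1)
        - 89 / 25 * (x + 1) + 67 / 40 * (h + c1) - 3 / 40 * (a - c1) - 83 / 800
        - 1 / 10 + (3 * d1 + c1) / 320"
      "comparisons_closed_form (n + 2) = 9 / 5 * (x + 2) * (h + c1 + c2)
        - 1 / 5 * (x + 2) * (a - c1 + c2) - 89 / 25 * (x + 2) + 67 / 40 * (h + c1 + c2)
        - 3 / 40 * (a - c1 + c2) - 83 / 800 + 1 / 10 - (d1 + 3 * c1) / 320"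
      using True unfolding comparisons_closed_form_def h a x cdefs ddefs
      by (simp_all add: defs add_ac)
    have pc: "partition_cost n = 3 / 2 * x + (h - a) / 4 - 19 / 8 - d1 / 8"
      "partition_cost (n + 1) = 3 / 2 * (x + 1) + (h + c1 - (a - c1)) / 4 - 19 / 8 - 3 / 8 * c1"
      "partition_cost (n + 2) = 3 / 2 * (x + 2) + (h + c1 + c2 - (a - c1 + c2)) / 4 - 19 / 8 - c1 / 8"
      using True unfolding partition_cost_def h a x cdefs ddefs
      by (simp_all add: defs add_ac)
    have "d1 * x = 1 + d1" "d3 * x = 1 + 3 * d3" using d by (simp_all add: algebra_simps)
    note reduce = c_reduce this this[THEN mult_reduce]
    show ?thesis unfolding cl pc x by (simp add: algebra_simps) (simp add: reduce field_simps)
  next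
    case False
    have a: "alt_harm (n + 1) = a + c1" "alt_harm (n + 2) = a + c1 - c2"
      using False by (simp_all add: defs cdefs alt_harm_Suc add_ac)
    define d0 d2 where "d0 = 1 / x" "d2 = 1 / (x - 2)"
    note ddefs = this
    have d: "x * d0 = 1" "(x - 2) * d2 = 1" using assms by (simp_all add: defs ddefs)
    have cl: "comparisons_closed_form n = 9 / 5 * x * h - 1 / 5 * x * a - 89 / 25 * x + 67 / 40 * h
        - 3 / 40 * a - 83 / 800 - 1 / 10 + (3 * d2 + d0) / 320"
      "comparisons_closed_form (n + 1) = 9 / 5 * (x + 1) * (h + c1) - 1 / 5 * (x + 1) * (a + c1)
        - 89 / 25 * (x + 1) + 67 / 40 * (h + c1) - 3 / 40 * (a + c1) - 83 / 800
        + 1 / 10 - (d2 + 3 * d0) / 320"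
      "comparisons_closed_form (n + 2) = 9 / 5 * (x + 2) * (h + c1 + c2)
        - 1 / 5 * (x + 2) * (a + c1 - c2) - 89 / 25 * (x + 2) + 67 / 40 * (h + c1 + c2)
        - 3 / 40 * (a + c1 - c2) - 83 / 800 - 1 / 10 + (3 * d0 + c2) / 320"
      using False unfolding comparisons_closed_form_def h a x cdefs ddefs
      by (simp_all add: defs add_ac)
    have pc: "partition_cost n = 3 / 2 * x + (h - a) / 4 - 19 / 8 - 3 / 8 * d0"
      "partition_cost (n + 1) = 3 / 2 * (x + 1) + (h + c1 - (a + c1)) / 4 - 19 / 8 - d0 / 8"
      "partition_cost (n + 2) = 3 / 2 * (x + 2) + (h + c1 + c2 - (a + c1 - c2)) / 4 - 19 / 8 - 3 / 8 * c2"
      using False unfolding partition_cost_def h a x cdefs ddefs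
      by (simp_all add: defs add_ac)
    have "d0 * x = 1" "d2 * x = 1 + 2 * d2" using d by (simp_all add: algebra_simps)
    note reduce = c_reduce this this[THEN mult_reduce]
    show ?thesis unfolding cl pc x by (simp add: algebra_simps) (simp add: reduce field_simps)
  qed
qed

text \<open>Both sides satisfy the same three-term recurrence with nonzero leading coefficient, so
  agreement at 4 and 5 suffices. These two values are computed from the original recurrence.\<close>

lemma expected_comparisons_eq:
  assumes "n \<ge> 4"
  shows "expected_comparisons n = comparisons_closed_form n"
proof -
  let ?E = expected_comparisons
  have E0: "?E 0 = 0"
    by (simp add: expected_comparisons_altdef count_comparisons.simps)
  have E1: "?E 1 = 0"
    by (simp add: expected_comparisons_altdef count_comparisons.simps)
  have rec: "?E (n + 2) = partition_cost (n + 2) +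
      6 * (\<Sum>k\<le>n. real (n + 1 - k) * ?E k) / ((real n + 1) * (real n + 2))" for n
  proof -
    define c where "c = (real n + 1) * (real n + 2)"
    have "c \<noteq> 0" by (simp add: c_def)
    moreover have "c * ?E (n + 2) =
        c * partition_cost (n + 2) + 6 * (\<Sum>k\<le>n. real (n + 1 - k) * ?E k)"
      using expected_comparisons_rec[of n] unfolding total_classification_cost_eq
      by (simp only: c_def)
    ultimately have "?E (n + 2) = (c * partition_cost (n + 2) + 6 * (\<Sum>k\<le>n. real (n + 1 - k) * ?E k)) / c"
      by (metis nonzero_mult_div_cancel_left)
    with \<open>c \<noteq> 0\<close> show ?thesis unfolding c_def[symmetric] by (simp add: add_divide_distrib)
  qed
  have E2: "?E 2 = 1"
    using rec[of 0] E0 by (simp add: partition_cost_def harm_def alt_harm_def eval_nat_numeral)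
  have E3: "?E 3 = 8 / 3" using rec[of 1] E0 E1
    by (simp add: partition_cost_def) (simp add: harm_def alt_harm_def eval_nat_numeral)
  have [simp]: "{..2::nat} = {0, 1, 2}" "{..3::nat} = {0, 1, 2, 3}" by auto
  have E4: "?E 4 = 19 / 4" using rec[of 2] E0 E1 E2
    by (simp add: partition_cost_def) (simp add: harm_def alt_harm_def eval_nat_numeral)
  have E5: "?E 5 = 433 / 60" using rec[of 3] E0 E1 E2 E3
    by (simp add: partition_cost_def) (simp add: harm_def alt_harm_def eval_nat_numeral)
  have "?E (n + 4) = comparisons_closed_form (n + 4)" for n
  proof (induction n rule: induct_nat_012)
    case 0
    show ?case using E4
      by (simp add: comparisons_closed_form_def) (simp add: harm_def alt_harm_def eval_nat_numeral)
  next
    case 1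
    show ?case using E5
      by (simp add: comparisons_closed_form_def) (simp add: harm_def alt_harm_def eval_nat_numeral)
  next
    case (ge2 n)
    let ?c = "(real n + 5) * (real n + 6)"
    have "?c * ?E (n + 6) = ?c * comparisons_closed_form (n + 6)"
      using closed_form_second_difference[of "n + 4"] expected_comparisons_second_difference[of "n + 2"] ge2
      by (simp add: eval_nat_numeral algebra_simps)
    hence "?E (n + 6) = comparisons_closed_form (n + 6)" by (simp del: mult_eq_0_iff)
    thus ?case by (simp add: eval_nat_numeral)
  qed
  from this[of "n - 4"] assms show ?thesis by simp
qed

subsection \<open>Asymptotics of harmonic numbers\<close>

text \<open>The asymptotic series of \<open>harm n - ln n - euler_mascheroni\<close> up to order 6;
  its coefficients after \<open>1 / 2\<close> are \<open>- B / (2 * j)\<close> with \<open>B\<close>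
  the Bernoulli number of index \<open>2 * j\<close>.\<close>

definition harm_remainder :: "real \<Rightarrow> real" where
  "harm_remainder x = 1 / (2 * x) - 1 / (12 * x ^ 2) + 1 / (120 * x ^ 4) - 1 / (252 * x ^ 6)"

text \<open>The next term of the series is scaled by \<open>c\<close>, so \<open>c = 0\<close> and
  \<open>c = 1\<close> give two consecutive partial sums.\<close>

definition harm_expansion :: "real \<Rightarrow> real \<Rightarrow> real" where
  "harm_expansion c x = ln x + harm_remainder x + c / (240 * x ^ 8)"

definition harm_expansion_deriv :: "real \<Rightarrow> real \<Rightarrow> real" where
  "harm_expansion_deriv c x = 1 / x - 1 / 2 * (1 / x ^ 2) + 1 / 6 * (1 / x ^ 3)
     - 1 / 30 * (1 / x ^ 5) + 1 / 42 * (1 / x ^ 7) - c / 30 * (1 / x ^ 9)"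

lemma DERIV_inverse_power:
  assumes "x > (0 :: real)"
  shows "((\<lambda>x. a / (b * x ^ n)) has_real_derivative - (real n * a / b) * (1 / x ^ Suc n)) (at x)"
proof -
  have "((\<lambda>x. (a / b) * inverse x ^ n) has_real_derivative
      (a / b) * (real n * inverse x ^ (n - 1) * (- (inverse x * inverse x)))) (at x)"
    using assms by (intro DERIV_cmult) (auto intro!: derivative_eq_intros simp: power2_eq_square)
  also have "(\<lambda>x. (a / b) * inverse x ^ n) = (\<lambda>x. a / (b * x ^ n))"
    by (simp add: fun_eq_iff divide_inverse power_inverse)
  also have "(a / b) * (real n * inverse x ^ (n - 1) * (- (inverse x * inverse x))) =
      - (real n * a / b) * (1 / x ^ Suc n)"
    by (cases n) (simp_all add: divide_inverse power_inverse mult_ac)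
  finally show ?thesis .
qed

lemma DERIV_harm_expansion:
  assumes "x > 0"
  shows "(harm_expansion c has_real_derivative harm_expansion_deriv c x) (at x)"
proof -
  have "(harm_expansion c has_real_derivative
     1 / x + - (real 1 * 1 / 2) * (1 / x ^ Suc 1) - - (real 2 * 1 / 12) * (1 / x ^ Suc 2)
     + - (real 4 * 1 / 120) * (1 / x ^ Suc 4) - - (real 6 * 1 / 252) * (1 / x ^ Suc 6)
     + - (real 8 * c / 240) * (1 / x ^ Suc 8)) (at x)"
    unfolding harm_expansion_def[abs_def] harm_remainder_def add_diff_eq add.assoc[symmetric]
    using DERIV_inverse_power[OF assms, of 1 2 1] DERIV_inverse_power[OF assms, of 1 12 2]
      DERIV_inverse_power[OF assms, of 1 120 4] DERIV_inverse_power[OF assms, of 1 252 6]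
      DERIV_inverse_power[OF assms, of c 240 8] DERIV_ln_divide[OF assms]
    unfolding power_one_right
    by (intro DERIV_add DERIV_diff) assumption+
  thus ?thesis by (simp add: harm_expansion_deriv_def eval_nat_numeral)
qed

lemma DERIV_harm_expansion_diff:
  assumes "x > 0"
  shows "((\<lambda>x. harm_expansion c (x + 1) - harm_expansion c x - 1 / (x + 1)) has_real_derivative
    harm_expansion_deriv c (x + 1) - harm_expansion_deriv c x + 1 / (x + 1) ^ 2) (at x)"
proof -
  have 1: "((\<lambda>x. harm_expansion c (x + 1)) has_real_derivative harm_expansion_deriv c (x + 1)) (at x)"
    using DERIV_harm_expansion[of "x + 1" c] assms by (simp add: DERIV_shift)
  have 2: "((\<lambda>x. 1 / (x + 1)) has_real_derivative - (1 / (x + 1) ^ 2)) (at x)"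
    using assms by (auto intro!: derivative_eq_intros simp: power2_eq_square divide_simps)
  show ?thesis
    using DERIV_diff[OF DERIV_diff[OF 1 DERIV_harm_expansion[OF assms]] 2] by simp
qed

lemma harm_expansion_diff_tendsto:
  "((\<lambda>x. harm_expansion c (x + 1) - harm_expansion c x - 1 / (x + 1)) \<longlongrightarrow> 0) at_top"
  unfolding harm_expansion_def harm_remainder_def by real_asymp

text \<open>Over the common denominator \<open>x ^ 7 * (x + 1) ^ 7\<close> the numerator is the
  negative of a polynomial with positive coefficients.\<close>

lemma harm_expansion_0_deriv_diff:
  assumes x: "x > 0"
  shows "harm_expansion_deriv 0 (x + 1) - harm_expansion_deriv 0 x + 1 / (x + 1) ^ 2 < 0"
proof -
  define y where "y = x + 1"
  have y: "y > 0" using x by (simp add: y_def)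
  define D where "D = x ^ 7 * y ^ 7"
  have D: "D > 0" using x y by (simp add: D_def)
  \<comment> \<open>Every reciprocal power is brought to the denominator \<open>D\<close>;
    \<open>7 - k\<close> is subtraction of naturals, hence the bound on \<open>k\<close>.\<close>
  have px: "1 / x ^ k = x ^ (7 - k) * y ^ 7 / D" and py: "1 / y ^ k = x ^ 7 * y ^ (7 - k) / D"
    if "k \<le> 7" for k using x y that by (simp_all add: D_def power_diff)
  have "harm_expansion_deriv 0 y - harm_expansion_deriv 0 x + 1 / y ^ 2 =
      - ((1/42 + 1/6 * x + 7/15 * x ^ 2 + 3/5 * x ^ 3 + 3/10 * x ^ 4) / D)"
    using D px[of 1] py[of 1]
    unfolding harm_expansion_deriv_def
    by (simp add: px py divide_simps) (simp add: y_def, algebra)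
  also have "\<dots> < 0"
    using x D by (auto intro!: divide_pos_pos add_pos_pos)
  finally show ?thesis by (simp add: y_def)
qed

text \<open>The difference of the two sides is strictly decreasing with limit 0 at infinity, hence
  positive.\<close>

lemma harm_expansion_0_diff:
  assumes "x > 0"
  shows "harm_expansion 0 (x + 1) - harm_expansion 0 x > 1 / (x + 1)"
proof -
  have "harm_expansion 0 (x + 1) - harm_expansion 0 x - 1 / (x + 1) > 0"
  proof (rule DERIV_neg_imp_decreasing_at_top[OF _ harm_expansion_diff_tendsto])
    fix y assume "y \<ge> x"
    hence "y > 0" using assms by simp
    thus "\<exists>D. ((\<lambda>x. harm_expansion 0 (x + 1) - harm_expansion 0 x - 1 / (x + 1))
        has_real_derivative D) (at y) \<and> D < 0"
      using DERIV_harm_expansion_diff harm_expansion_0_deriv_diff by blast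
  qed
  thus ?thesis by simp
qed

text \<open>The additional term of the series reverses the sign: over
  \<open>x ^ 9 * (x + 1) ^ 9\<close> the numerator has positive coefficients.\<close>

lemma harm_expansion_1_deriv_diff:
  assumes x: "x > 0"
  shows "harm_expansion_deriv 1 (x + 1) - harm_expansion_deriv 1 x + 1 / (x + 1) ^ 2 > 0"
proof -
  define y where "y = x + 1"
  have y: "y > 0" using x by (simp add: y_def)
  define D where "D = x ^ 9 * y ^ 9"
  have D: "D > 0" using x y by (simp add: D_def)
  have px: "1 / x ^ k = x ^ (9 - k) * y ^ 9 / D" and py: "1 / y ^ k = x ^ 9 * y ^ (9 - k) / D"
    if "k \<le> 9" for k using x y that by (simp_all add: D_def power_diff)
  have "harm_expansion_deriv 1 y - harm_expansion_deriv 1 x + 1 / y ^ 2 =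
       (1/30 + 3/10 * x + 247/210 * x ^ 2 + 181/70 * x ^ 3 + 709/210 * x ^ 4 + 5/2 * x ^ 5 + 5/6 * x ^ 6) / D"
    using D px[of 1] py[of 1]
    unfolding harm_expansion_deriv_def
    by (simp add: px py divide_simps) (simp add: y_def, algebra)
  also have "\<dots> > 0"
    using x D by (intro divide_pos_pos) (auto intro!: add_pos_pos)
  finally show ?thesis by (simp add: y_def)
qed

lemma harm_expansion_1_diff:
  assumes "x > 0"
  shows "harm_expansion 1 (x + 1) - harm_expansion 1 x < 1 / (x + 1)"
proof -
  \<comment> \<open>The bound is written \<open>- 0\<close> because \<open>tendsto_minus\<close>
    supplies the limit in this form.\<close>
  have "- (harm_expansion 1 (x + 1) - harm_expansion 1 x - 1 / (x + 1)) > - 0"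
  proof (rule DERIV_neg_imp_decreasing_at_top[OF _ tendsto_minus[OF harm_expansion_diff_tendsto]])
    fix y assume "y \<ge> x"
    hence y: "y > 0" using assms by simp
    show "\<exists>D. ((\<lambda>x. - (harm_expansion 1 (x + 1) - harm_expansion 1 x - 1 / (x + 1)))
        has_real_derivative D) (at y) \<and> D < 0"
      using DERIV_minus[OF DERIV_harm_expansion_diff[OF y, of 1]] harm_expansion_1_deriv_diff[OF y]
      by (metis neg_less_0_iff_less)
  qed
  thus ?thesis by simp
qed

lemma harm_minus_expansion_tendsto:
  "(\<lambda>n. harm n - harm_expansion c (real n)) \<longlonglongrightarrow> euler_mascheroni"
proof -
  have "(\<lambda>n. ln (real n) - harm_expansion c (real n)) \<longlonglongrightarrow> 0"
    unfolding harm_expansion_def harm_remainder_def by real_asymp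
  from tendsto_add[OF euler_mascheroni_LIMSEQ this] show ?thesis by simp
qed

text \<open>The difference between \<open>harm\<close> and the expansion tends to
  \<open>euler_mascheroni\<close>, decreasing for \<open>c = 0\<close> and increasing for
  \<open>c = 1\<close>; a monotone sequence stays on one side of its limit.\<close>

lemma harm_bounds:
  assumes "n > 0"
  shows "harm n \<ge> euler_mascheroni + harm_expansion 0 (real n)"
    and "harm n \<le> euler_mascheroni + harm_expansion 1 (real n)"
proof -
  \<comment> \<open>The shift by \<open>Suc\<close> keeps the argument of the expansion
    positive.\<close>
  let ?f = "\<lambda>c n. harm (Suc n) - harm_expansion c (real (Suc n))"
  have lim: "?f c \<longlonglongrightarrow> euler_mascheroni" for c
    by (rule LIMSEQ_Suc) (rule harm_minus_expansion_tendsto)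
  have "decseq (?f 0)"
  proof (rule decseq_SucI)
    fix n
    show "?f 0 (Suc n) \<le> ?f 0 n"
      using harm_expansion_0_diff[of "real (Suc n)"]
      by (simp add: harm_Suc[of "Suc n"] inverse_eq_divide add_ac)
  qed
  from decseq_ge[OF this lim, of "n - 1"] assms
  show "harm n \<ge> euler_mascheroni + harm_expansion 0 (real n)" by simp
  have "incseq (?f 1)"
  proof (rule incseq_SucI)
    fix n
    show "?f 1 n \<le> ?f 1 (Suc n)"
      using harm_expansion_1_diff[of "real (Suc n)"]
      by (simp add: harm_Suc[of "Suc n"] inverse_eq_divide add_ac)
  qed
  from incseq_le[OF this lim, of "n - 1"] assms
  show "harm n \<le> euler_mascheroni + harm_expansion 1 (real n)" by simp
qed

section \<open>Numerical enclosures and error terms\<close>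

lemma ln_2_bounds:
  "ln (2 :: real) \<in> {693147180559945309 / 10 ^ 18..693147180559945310 / 10 ^ 18}"
proof -
  \<comment> \<open>Twenty terms of the series in odd powers of
    \<open>(2 - 1) / (2 + 1) = 1 / 3\<close>; the remainder is below
    \<open>1 / 10 ^ 20\<close>.\<close>
  have "ln (2 :: real) \<in> {(\<Sum>k<20. 2*((2-1)/(2+1))^(2*k+1) / of_nat (2*k+1))..
     (\<Sum>k<20. 2*((2-1)/(2+1))^(2*k+1) / of_nat (2*k+1)) +
     2 * (((2-1)/(2+1))^(2*20+1) / (1 - ((2-1)/(2+1))^2) / of_nat (2*20+1))}"
    by (rule ln_approx_bounds) simp
  thus ?thesis by (simp add: lessThan_nat_numeral lessThan_Suc power_divide)
qed

text \<open>At \<open>n = 64\<close> the two bounds for \<open>harm\<close> differ by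
  \<open>1 / (240 * 64 ^ 8)\<close>, less than \<open>2 / 10 ^ 17\<close>, and the logarithm reduces
  to \<open>ln 2\<close>.\<close>

lemma euler_mascheroni_bounds_17:
  "euler_mascheroni \<in> {57721566490153282 / 10 ^ 17..57721566490153289 / 10 ^ 17 :: real}"
proof -
  have "ln (64 :: real) = ln (2 ^ 6)" by simp
  also have "\<dots> = 6 * ln 2" by (subst ln_realpow) auto
  finally have "ln (64 :: real) = 6 * ln 2" .
  moreover have "harm 64 = (623171679694215690971693339 / 131362987122535807501262400 :: real)" by (simp add: harm_expand)
  ultimately show ?thesis
    using harm_bounds[of 64] ln_2_bounds by (simp add: harm_expansion_def harm_remainder_def)
qed

lemma harm_expansion_error:
  "(\<lambda>n. harm n - (euler_mascheroni + harm_expansion 0 (real n))) \<in> O(\<lambda>n. 1 / real n ^ 6)"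
proof (rule bigoI[of _ 1], rule eventually_mono[OF eventually_gt_at_top[of 0]])
  fix n :: nat assume n: "n > 0"
  have "harm_expansion 1 (real n) - harm_expansion 0 (real n) = 1 / (240 * real n ^ 8)"
    by (simp add: harm_expansion_def)
  also have "\<dots> \<le> 1 / real n ^ 6"
    using n by (intro divide_left_mono) (auto intro: order.trans[OF power_increasing[of 6 8]])
  finally show "norm (harm n - (euler_mascheroni + harm_expansion 0 (real n))) \<le>
      1 * norm (1 / real n ^ 6)"
    using harm_bounds[OF n] by simp
qed

definition harm_error :: "nat \<Rightarrow> real" where
  "harm_error n = harm n - (euler_mascheroni + harm_expansion 0 (real n))"

text \<open>Harmonic numbers enter the closed form with coefficients linear in \<open>n\<close>; the
  arguments \<open>k\<close>, \<open>2 * k\<close> and \<open>2 * k + 1\<close> are those that arise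
  when the parities are separated.\<close>

lemma harm_error_linear_bigo:
  "(\<lambda>k. (a * real k + b) * harm_error k) \<in> O(\<lambda>k. 1 / real k ^ 4)"
  "(\<lambda>k. (a * real k + b) * harm_error (2 * k)) \<in> O(\<lambda>k. 1 / real k ^ 4)"
  "(\<lambda>k. (a * real k + b) * harm_error (2 * k + 1)) \<in> O(\<lambda>k. 1 / real k ^ 4)"
proof -
  have *: "(\<lambda>k. (a * real k + b) * harm_error (h k)) \<in> O(\<lambda>k. 1 / real k ^ 4)"
    if h: "filterlim h at_top at_top" "(\<lambda>k. 1 / real (h k) ^ 6) \<in> O(\<lambda>k. 1 / real k ^ 6)" for h
  proof -
    have "(\<lambda>k. harm_error (h k)) \<in> O(\<lambda>k. 1 / real (h k) ^ 6)"
      unfolding harm_error_def by (rule landau_o.big.compose[OF harm_expansion_error h(1)])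
    also note h(2)
    finally have 1: "(\<lambda>k. harm_error (h k)) \<in> O(\<lambda>k. 1 / real k ^ 6)" .
    have 2: "(\<lambda>k. a * real k + b) \<in> O(\<lambda>k. real k)"
      by (intro sum_in_bigo landau_o.big.cmult_in_iff') real_asymp+
    have "(\<lambda>k. (a * real k + b) * harm_error (h k)) \<in> O(\<lambda>k. real k * (1 / real k ^ 6))"
      by (rule landau_o.big.mult[OF 2 1])
    also have "(\<lambda>k. real k * (1 / real k ^ 6)) \<in> O(\<lambda>k. 1 / real k ^ 4)"
      by real_asymp
    finally show ?thesis .
  qed
  show "(\<lambda>k. (a * real k + b) * harm_error k) \<in> O(\<lambda>k. 1 / real k ^ 4)"
    by (rule *) (auto simp: filterlim_ident)
  show "(\<lambda>k. (a * real k + b) * harm_error (2 * k)) \<in> O(\<lambda>k. 1 / real k ^ 4)"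
    by (rule *) (real_asymp | simp)+
  show "(\<lambda>k. (a * real k + b) * harm_error (2 * k + 1)) \<in> O(\<lambda>k. 1 / real k ^ 4)"
    by (rule *) (real_asymp | simp)+
qed

lemma harm_eq: "harm n = ln (real n) + euler_mascheroni + harm_remainder (real n) + harm_error n"
  by (simp add: harm_error_def harm_expansion_def)

subsection \<open>The asymptotic expansion\<close>

text \<open>The alternating sum is twice its even-indexed part minus the sum of all
  \<open>1 / m\<close>, and twice the even-indexed part is \<open>harm k\<close>.\<close>

lemma alt_harm_even: "alt_harm (2 * k) = harm k - harm (2 * k)"
proof (induction k)
  case 0
  show ?case by (simp add: alt_harm_def harm_def)
next
  case (Suc k)
  have "1 / (real k + 1) = 2 * (1 / (2 * real k + 2))" by (simp add: divide_simps)
  thus ?case using Suc by (simp add: alt_harm_Suc harm_Suc inverse_eq_divide add_ac)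
qed

lemma alt_harm_odd: "alt_harm (2 * k + 1) = harm k - harm (2 * k) - 1 / (2 * real k + 1)"
  using alt_harm_Suc[of "2 * k"] by (simp add: alt_harm_even)

lemma bigo_even_odd:
  fixes f g :: "nat \<Rightarrow> real"
  assumes "(\<lambda>k. f (2 * k)) \<in> O(\<lambda>k. g (2 * k))"
    and "(\<lambda>k. f (2 * k + 1)) \<in> O(\<lambda>k. g (2 * k + 1))"
  shows "f \<in> O(g)"
proof -
  obtain c1 where 1: "eventually (\<lambda>k. norm (f (2 * k)) \<le> c1 * norm (g (2 * k))) at_top"
    using assms(1) by (elim landau_o.bigE)
  obtain c2 where 2: "eventually (\<lambda>k. norm (f (2 * k + 1)) \<le> c2 * norm (g (2 * k + 1))) at_top"
    using assms(2) by (elim landau_o.bigE)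
  from eventually_conj[OF 1 2] obtain N where N: "\<And>k. k \<ge> N \<Longrightarrow>
      norm (f (2 * k)) \<le> c1 * norm (g (2 * k)) \<and>
      norm (f (2 * k + 1)) \<le> c2 * norm (g (2 * k + 1))"
    unfolding eventually_at_top_linorder by blast
  show ?thesis
  proof (rule bigoI[of _ "max c1 c2"], rule eventually_at_top_linorderI[of "2 * N"])
    fix n assume n: "n \<ge> 2 * N"
    have "c1 * norm (g n) \<le> max c1 c2 * norm (g n)" "c2 * norm (g n) \<le> max c1 c2 * norm (g n)"
      by (auto intro: mult_right_mono)
    moreover have "norm (f n) \<le> c1 * norm (g n) \<or> norm (f n) \<le> c2 * norm (g n)"
    proof (cases "even n")
      case True
      then obtain k where "n = 2 * k" by (elim evenE)
      with N[of k] n show ?thesis by simp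
    next
      case False
      then obtain k where "n = 2 * k + 1" by (elim oddE)
      with N[of k] n show ?thesis by simp
    qed
    ultimately show "norm (f n) \<le> max c1 c2 * norm (g n)" by linarith
  qed
qed

theorem corollary10p4:
  fixes A B C D E F G :: real
  assumes "A = 9/5 * euler_mascheroni + 1/5 * ln 2 - 89/25"
    and "B = 67/40"
    and "C = 67/40 * euler_mascheroni + 3/40 * ln 2 + 637/800"
    and "D = 11/16"
    and "E = - 67/480"
    and "F = - 1/8"
    and "G = 31/400"
  shows "((\<lambda>n. expected_comparisons n -
            (9/5 * real n * ln (real n) + A * real n + B * ln (real n) + C
             + D / real n + E / real n ^ 2 + (F * of_bool (even n) + G) / real n ^ 3))
           \<in> O(\<lambda>n. 1 / real n ^ 4))
         \<and> (- 2.3823823670653 < A \<and> A \<le> - 2.3823823670652)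
         \<and> (1.81507227725206 \<le> C \<and> C < 1.81507227725207)"
proof (intro conjI)
  show "- 2.3823823670653 < A" "A \<le> - 2.3823823670652"
    "1.81507227725206 \<le> C" "C < 1.81507227725207"
    using ln_2_bounds euler_mascheroni_bounds_17 unfolding assms by simp_all
  define r where "r n = expected_comparisons n -
            (9/5 * real n * ln (real n) + A * real n + B * ln (real n) + C
             + D / real n + E / real n ^ 2 + (F * of_bool (even n) + G) / real n ^ 3)" for n
  \<comment> \<open>For \<open>n = 2 * k\<close> all logarithms and \<open>euler_mascheroni\<close>
    cancel in \<open>r\<close>. Apart from \<open>harm_error\<close> there remains the rational
    function \<open>r0\<close>; its last line comes from \<open>D\<close>, \<open>E\<close> and
    \<open>F + G\<close>, and \<open>- 4 / 5\<close> is
    \<open>1 / 10 - 83 / 800 - 637 / 800\<close>.\<close>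
  define r0 where "r0 k = (18 / 5 * k + 67 / 40) * harm_remainder (2 * k)
    - (2 / 5 * k + 3 / 40) * (harm_remainder k - harm_remainder (2 * k)) - 4 / 5
    - (1 / (2 * k - 3) + 3 / (2 * k - 1)) / 320
    - 11 / (32 * k) + 67 / (1920 * k ^ 2) + 19 / (3200 * k ^ 3)" for k :: real
  \<comment> \<open>The counterpart for \<open>n = 2 * k + 1\<close>: here \<open>F\<close> drops
    out and \<open>- 1 / 10\<close> takes the place of \<open>1 / 10\<close>.\<close>
  define r1 where "r1 k = (9 / 5 * (2 * k + 1) + 67 / 40) * harm_remainder (2 * k + 1)
    - (1 / 5 * (2 * k + 1) + 3 / 40) *
       (harm_remainder k - harm_remainder (2 * k) - 1 / (2 * k + 1)) - 1
    + (3 / (2 * k - 1) + 1 / (2 * k + 1)) / 320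
    - 11 / (16 * (2 * k + 1)) + 67 / (480 * (2 * k + 1) ^ 2) - 31 / (400 * (2 * k + 1) ^ 3)"
    for k :: real
  have "eventually (\<lambda>k. r (2 * k) = r0 (real k)
      + (18 / 5 * real k + 67 / 40) * harm_error (2 * k)
      + (2 / 5 * real k + 3 / 40) * harm_error (2 * k)
      - (2 / 5 * real k + 3 / 40) * harm_error k) at_top"
    using eventually_ge_at_top[of 3]
  proof eventually_elim
    case (elim k)
    have "ln (real (2 * k)) = ln 2 + ln (real k)" using elim by (simp add: ln_mult)
    hence alt: "alt_harm (2 * k) = - ln 2 + harm_remainder (real k) - harm_remainder (2 * real k)
        + harm_error k - harm_error (2 * k)"
      unfolding alt_harm_even harm_eq by simp
    show ?case
      using elim unfolding r_def r0_def assms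
      by (simp add: expected_comparisons_eq comparisons_closed_form_def alt harm_eq[of "2 * k"]
          power_mult_distrib) (simp add: field_simps)
  qed
  note eq = this
  \<comment> \<open>This is where \<open>D\<close>, \<open>E\<close> and \<open>F + G\<close> are
    confirmed: all terms of \<open>r0\<close> up to order \<open>1 / k ^ 3\<close> cancel.\<close>
  have "(\<lambda>k. r0 (real k)) \<in> O(\<lambda>k. 1 / real k ^ 4)"
    unfolding r0_def harm_remainder_def by real_asymp
  hence "(\<lambda>k. r (2 * k)) \<in> O(\<lambda>k. 1 / real k ^ 4)"
    by (subst landau_o.big.in_cong[OF eq]) (intro sum_in_bigo harm_error_linear_bigo)
  also have "(\<lambda>k. 1 / real k ^ 4) \<in> O(\<lambda>k. 1 / real (2 * k) ^ 4)"
    by real_asymp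
  finally have even: "(\<lambda>k. r (2 * k)) \<in> O(\<lambda>k. 1 / real (2 * k) ^ 4)" .
  have "eventually (\<lambda>k. r (2 * k + 1) = r1 (real k)
      + (18 / 5 * real k + 139 / 40) * harm_error (2 * k + 1)
      + (2 / 5 * real k + 11 / 40) * harm_error (2 * k)
      - (2 / 5 * real k + 11 / 40) * harm_error k) at_top"
    using eventually_ge_at_top[of 3]
  proof eventually_elim
    case (elim k)
    have "ln (real (2 * k)) = ln 2 + ln (real k)" using elim by (simp add: ln_mult)
    hence alt: "alt_harm (2 * k + 1) = - ln 2 + harm_remainder (real k)
        - harm_remainder (2 * real k) - 1 / (2 * real k + 1) + harm_error k - harm_error (2 * k)"
      unfolding alt_harm_odd harm_eq by simp
    have n: "real (2 * k + 1) = 2 * real k + 1" by simp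
    have odd: "\<not> even (2 * k + 1)" by simp
    have E: "expected_comparisons (2 * k + 1) = comparisons_closed_form (2 * k + 1)"
      using elim by (intro expected_comparisons_eq) simp
    have red: "2 * real k + 1 - 2 = 2 * real k - 1" by simp
    show ?case
      unfolding r_def r1_def assms E comparisons_closed_form_def alt harm_eq[of "2 * k + 1"]
        n if_not_P[OF odd] red using odd
      by (simp only: of_bool_def if_False)
         (simp add: algebra_simps add_divide_distrib diff_divide_distrib,
          simp add: divide_simps add_nonneg_eq_0_iff)
  qed
  note eq = this
  \<comment> \<open>The odd case confirms \<open>G\<close> by itself, with the same \<open>D\<close>
    and \<open>E\<close>.\<close>
  have "(\<lambda>k. r1 (real k)) \<in> O(\<lambda>k. 1 / real k ^ 4)"
    unfolding r1_def harm_remainder_def by real_asymp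
  hence "(\<lambda>k. r (2 * k + 1)) \<in> O(\<lambda>k. 1 / real k ^ 4)"
    by (subst landau_o.big.in_cong[OF eq]) (intro sum_in_bigo harm_error_linear_bigo)
  also have "(\<lambda>k. 1 / real k ^ 4) \<in> O(\<lambda>k. 1 / real (2 * k + 1) ^ 4)"
    by real_asymp
  finally have odd: "(\<lambda>k. r (2 * k + 1)) \<in> O(\<lambda>k. 1 / real (2 * k + 1) ^ 4)" .
  show "(\<lambda>n. expected_comparisons n -
            (9/5 * real n * ln (real n) + A * real n + B * ln (real n) + C
             + D / real n + E / real n ^ 2 + (F * of_bool (even n) + G) / real n ^ 3))
           \<in> O(\<lambda>n. 1 / real n ^ 4)"
    using bigo_even_odd[of r "\<lambda>n. 1 / real n ^ 4", OF even odd] unfolding r_def .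
qed

end
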